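(* Let $P\subset\mathbf{R}^n$ be an $n$-dimensional parallelotope with $m$ pairs of opposite facets, centered at the origin and described as $$P=\{x\in\mathbf{R}^n: -\tfrac12 p_j^Tt_j\le p_j^Tx\le \tfrac12 p_j^Tt_j,\ 1\le j\le m\},$$ where, for each $j$, $p_j$ is a facet vector (normal vector) of the facet $F_j=\{x\in P: p_j^Tx=\tfrac12p_j^Tt_j\}$ and $\tfrac12 t_j$ is the center of $F_j$. Let $A$ be a non-singular real $n\times n$ matrix, so that $Q=A^TA$ is a symmetric positive definite matrix. Then the following assertions are equivalent: (i) the map $x\mapsto Ax$ transforms $P$ into a Voronoi polytope; (ii) $P$ is the Voronoi polytope $P_Q$ with respect to the positive definite quadratic form $f(x)=x^TQx$, i.e. $P=P_Q(0)$; (iii) one can choose scalars $\gamma_j$ such that $\gamma_jp_j=Qt_j$ for all $1\le j\le m$.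
   Context: A parallelotope is a convex polytope whose translates fill the space $\mathbf{R}^n$ facet to facet without overlapping interiors (a tiling). Every parallelotope is centrally symmetric, and so is each of its facets. With $P=P(0)$ centered at the origin, for each facet $F_j$ with center $\frac12t_j$, the translate $P(t_j)=P+t_j$ is the parallelotope of the tiling adjacent to $P$ along $F_j$; $t_j$ is called a translation vector (lattice vector). One index $j$ is used for each pair of opposite facets, and the facet vector $p_j$ is determined up to a scalar multiple. Put $\mathcal T=\{t_j:1\le j\le m\}$ and $\pm\mathcal T=\{\pm t_j: 1\le j\le m\}$; $\mathcal T$ generates the lattice $L(\mathcal T)$ of centers of the parallelotopes of the tiling. The Voronoi polytope of a lattice $L\subset\mathbf{R}^n$ related to a point $t_0\in L$ is the set of points of $\mathbf{R}^n$ that are at least as near to $t_0$ as to any other point of $L$, in the usual Euclidean norm $x^2=x^Tx$. "A Voronoi polytope" in (i) means the Voronoi polytope of some full-rank lattice in $\mathbf{R}^n$ related to one of its points; assertion (i) for some $A$ is Voronoi's conjecture for $P$, that $P$ is affinely equivalent to a Voronoi polytope. For a symmetric positive definite $n\times n$ matrix $Q$, the Voronoi polytope with respect to the form $x^TQx$ is $$P_Q(0)=\{x\in\mathbf{R}^n: x^TQx\le (x-t)^TQ(x-t)\ \text{for all } t\in\pm\mathcal T\}.$$ *)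

theory Defs
  imports "HOL-Analysis.Analysis"
begin

definition center_of :: "'a::real_vector \<Rightarrow> 'a set \<Rightarrow> bool" where
  "center_of c S \<longleftrightarrow> (\<lambda>x. 2 *\<^sub>R c - x) ` S = S"

text \<open>The tiles are the translates of \<open>P\<close> by the vectors in \<open>D\<close>.  No lattice structure on \<open>D\<close>
  is assumed.  Facet to facet means that two distinct tiles meeting in dimension \<open>n - 1\<close> meet
  in a common facet.\<close>

definition facet_to_facet_tiling :: "'a::euclidean_space set \<Rightarrow> 'a set \<Rightarrow> bool" where
  "facet_to_facet_tiling P D \<longleftrightarrow>
     (\<Union>d\<in>D. (+) d ` P) = UNIV \<and>
     (\<forall>c\<in>D. \<forall>d\<in>D. c \<noteq> d \<longrightarrow>
        interior ((+) c ` P) \<inter> interior ((+) d ` P) = {} \<and>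
        (aff_dim ((+) c ` P \<inter> (+) d ` P) = int DIM('a) - 1 \<longrightarrow>
           (+) c ` P \<inter> (+) d ` P facet_of (+) c ` P \<and>
           (+) c ` P \<inter> (+) d ` P facet_of (+) d ` P))"

definition parallelotope :: "'a::euclidean_space set \<Rightarrow> bool" where
  "parallelotope P \<longleftrightarrow>
     polytope P \<and> aff_dim P = int DIM('a) \<and> (\<exists>D. facet_to_facet_tiling P D)"

text \<open>Full-rank lattices are the discrete additive subgroups that span the whole space.\<close>

definition full_rank_lattice :: "'a::euclidean_space set \<Rightarrow> bool" where
  "full_rank_lattice L \<longleftrightarrow>
     0 \<in> L \<and> (\<forall>x\<in>L. \<forall>y\<in>L. x - y \<in> L) \<and> discrete L \<and> span L = UNIV"

definition voronoi_cell :: "'a::euclidean_space set \<Rightarrow> 'a \<Rightarrow> 'a set" where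
  "voronoi_cell L c = {x. \<forall>s\<in>L. dist x c \<le> dist x s}"

definition voronoi_polytope :: "'a::euclidean_space set \<Rightarrow> bool" where
  "voronoi_polytope V \<longleftrightarrow> (\<exists>L c. full_rank_lattice L \<and> c \<in> L \<and> V = voronoi_cell L c)"

definition quad_form :: "real ^ 'n ^ 'n \<Rightarrow> real ^ 'n \<Rightarrow> real" where
  "quad_form Q x = x \<bullet> (Q *v x)"

text \<open>The Voronoi polytope at the origin with respect to the form of \<open>Q\<close>, where only the
  translation vectors \<open>t\<close> and \<open>- t\<close> with \<open>t \<in> T\<close> compete with the origin.\<close>

definition voronoi_form_polytope :: "real ^ 'n ^ 'n \<Rightarrow> (real ^ 'n) set \<Rightarrow> (real ^ 'n) set" where
  "voronoi_form_polytope Q T = {x. \<forall>t \<in> T \<union> uminus ` T. quad_form Q x \<le> quad_form Q (x - t)}"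

text \<open>One index for each pair of opposite facets \<open>F j\<close> and \<open>- F j\<close>.\<close>

definition facet_pairs :: "'a::euclidean_space set \<Rightarrow> nat \<Rightarrow> (nat \<Rightarrow> 'a set) \<Rightarrow> bool" where
  "facet_pairs P m F \<longleftrightarrow>
     (\<forall>j\<in>{1..m}. F j facet_of P) \<and>
     (\<forall>G. G facet_of P \<longrightarrow> (\<exists>!j. j \<in> {1..m} \<and> (G = F j \<or> G = uminus ` F j)))"

end

theory Submission
  imports Defs
begin

text \<open>
  All three conditions say that the hyperplane of each facet \<open>F j\<close> is the bisector of \<open>0\<close> and \<open>t j\<close>
  with respect to the form \<open>Q\<close>.  The matrix \<open>A\<close> is an isometry from this form to the Euclidean norm,
  so bisectors for \<open>Q\<close> correspond to Euclidean bisectors of the images under \<open>A\<close>.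

  For (iii) this is immediate: the facet vector \<open>p j\<close> is proportional to the normal vector \<open>Q t j\<close> of
  the bisector, both hyperplanes contain the center of \<open>F j\<close>, and a positive factor transforms the
  description of \<open>P\<close> by its facets into the description of the Voronoi polytope of the form.
  Conversely, if (ii) holds, then the bisector of \<open>t j\<close> supports \<open>P\<close> and contains the center of \<open>F j\<close>.
  Since \<open>F j\<close> is centrally symmetric, the bisector contains \<open>F j\<close>
  (\<open>supporting_at_center_imp_constant\<close>), and a set of codimension one determines its normal
  direction (\<open>parallel_if_constant_on_codim_1\<close>).

  If (i) holds, then the symmetry of \<open>P\<close> forces the lattice point of the Voronoi cell to be the
  origin.  The center of a facet of a Voronoi cell lies on some bisector, which as before contains
  the facet; the reflection that exchanges the two lattice points preserves the facet, so
  the center of the facet is the midpoint between them (\<open>voronoi_facet_center\<close>).  Hence \<open>A t j\<close> is that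
  lattice vector, and the hyperplane of \<open>F j\<close> is the bisector of \<open>t j\<close>.

  The step from (ii) to (i) needs the tiling.  The tile adjacent to a tile across the facet with center
  \<open>t j / 2\<close> is its translate by \<open>t j\<close> (\<open>tiling_translation_vector\<close>), so \<open>t j\<close> is a period of the
  tiling.  The periods form a lattice, and the translates of \<open>P\<close> by different periods have
  disjoint interiors.  A point \<open>x\<close> in the interior of \<open>P\<close> and the translate \<open>x - z\<close>, where \<open>z\<close> is a period
  nearest to \<open>x\<close> for the form, both lie in \<open>P\<close>, which is only possible for \<open>z = 0\<close>
  (\<open>tiling_voronoi_polytope\<close>).
\<close>

section \<open>Centers of symmetry\<close>

lemma center_ofD: "center_of c S \<Longrightarrow> x \<in> S \<Longrightarrow> 2 *\<^sub>R c - x \<in> S"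
  unfolding center_of_def by blast

lemma center_ofI:
  assumes "\<And>x. x \<in> S \<Longrightarrow> 2 *\<^sub>R c - x \<in> S"
  shows "center_of c S"
proof -
  have "x \<in> (\<lambda>x. 2 *\<^sub>R c - x) ` S" if "x \<in> S" for x
    using assms[OF that] by (rule rev_image_eqI) simp
  then show ?thesis
    unfolding center_of_def using assms by blast
qed

lemma center_mem:
  assumes "convex S" "S \<noteq> {}" "center_of c S"
  shows "c \<in> S"
proof -
  obtain x where x: "x \<in> S" using assms by blast
  have "(1/2) *\<^sub>R x + (1/2) *\<^sub>R (2 *\<^sub>R c - x) \<in> S"
    by (rule convexD[OF assms(1)]) (use x center_ofD[OF assms(3) x] in auto)
  then show ?thesis
    by (simp add: algebra_simps)
qed

text \<open>The orbit \<open>x\<close>, \<open>x + v\<close>, \<open>x + 2 v\<close>, \<open>\<dots>\<close> stays in \<open>S\<close> and is unbounded unless \<open>v = 0\<close>.  This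
  makes centers unique, excludes that a facet is a proper translate of itself inside its own
  hyperplane, and forces the translation vectors to span the space.\<close>

lemma bounded_translation_stable_imp_zero:
  fixes v :: "'a::real_normed_vector"
  assumes "bounded S" "S \<noteq> {}" and stable: "\<And>x. x \<in> S \<Longrightarrow> v + x \<in> S"
  shows "v = 0"
proof (rule ccontr)
  assume "v \<noteq> 0"
  obtain x where x: "x \<in> S" using assms by blast
  obtain B where B: "\<And>y. y \<in> S \<Longrightarrow> norm y \<le> B"
    using assms(1) unfolding bounded_iff by blast
  have iter: "of_nat k *\<^sub>R v + x \<in> S" for k :: nat
  proof (induction k)
    case (Suc k)
    from stable[OF Suc] show ?case by (simp add: algebra_simps)
  qed (use x in simp)
  obtain k :: nat where k: "B + norm x < real k * norm v"
    using reals_Archimedean3[of "norm v"] \<open>v \<noteq> 0\<close> by auto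
  have "norm (of_nat k *\<^sub>R v) \<le> norm (of_nat k *\<^sub>R v + x) + norm x"
    using norm_triangle_ineq4[of "of_nat k *\<^sub>R v + x" x] by simp
  with B[OF iter, of k] k show False
    by simp
qed

text \<open>The composition of two point reflections is the translation by twice the difference of their
  centers.\<close>

lemma center_of_unique:
  fixes S :: "'a::real_normed_vector set"
  assumes "bounded S" "S \<noteq> {}" "center_of c S" "center_of d S"
  shows "c = d"
proof -
  have "2 *\<^sub>R (c - d) + x \<in> S" if "x \<in> S" for x
    using center_ofD[OF assms(3) center_ofD[OF assms(4) that]] by (simp add: algebra_simps)
  from bounded_translation_stable_imp_zero[OF assms(1,2) this] show ?thesis
    by simp
qed

section \<open>Hyperplanes and facets\<close>

text \<open>A set of codimension one spans a single hyperplane, so two linear forms that are constant on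
  it have proportional normal vectors.\<close>

lemma parallel_if_constant_on_codim_1:
  fixes S :: "'a::euclidean_space set"
  assumes dim: "aff_dim S = int DIM('a) - 1" and "p \<noteq> 0"
    and p: "\<And>x. x \<in> S \<Longrightarrow> p \<bullet> x = b" and a: "\<And>x. x \<in> S \<Longrightarrow> a \<bullet> x = b'"
  obtains \<gamma> where "a = \<gamma> *\<^sub>R p"
proof -
  let ?H = "{x. p \<bullet> x = b}"
  have "S \<noteq> {}"
    using dim DIM_positive[where 'a='a] by (intro notI) simp
  have "affine hull S = ?H"
  proof (rule affine_dim_equal)
    show "affine hull S \<subseteq> ?H"
      by (rule hull_minimal) (use p affine_hyperplane in auto)
    show "aff_dim (affine hull S) = aff_dim ?H"
      using dim \<open>p \<noteq> 0\<close> by simp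
  qed (use \<open>S \<noteq> {}\<close> affine_hyperplane in auto)
  moreover have "affine hull S \<subseteq> {x. a \<bullet> x = b'}"
    by (rule hull_minimal) (use a affine_hyperplane in auto)
  ultimately have sub: "a \<bullet> x = b'" if "p \<bullet> x = b" for x
    using that by auto
  obtain x where x: "x \<in> S" using \<open>S \<noteq> {}\<close> by blast
  define w where "w = a - ((a \<bullet> p) / (p \<bullet> p)) *\<^sub>R p"
  have pw: "p \<bullet> w = 0"
    using \<open>p \<noteq> 0\<close> by (simp add: w_def inner_diff_right inner_commute)
  have "a \<bullet> (x + w) = b'"
    by (rule sub) (simp add: inner_add_right pw p[OF x])
  then have "a \<bullet> w = 0"
    using a[OF x] by (simp add: inner_add_right)
  moreover have "w \<bullet> w = a \<bullet> w - ((a \<bullet> p) / (p \<bullet> p)) * (p \<bullet> w)"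
    by (subst (1) w_def) (simp add: inner_diff_left)
  ultimately have "w = 0"
    using pw by simp
  then show ?thesis
    using that unfolding w_def by simp
qed

text \<open>The key observation on facets: a hyperplane that bounds a set and passes through its center of
  symmetry contains the whole set, since a point strictly below it would be reflected to a point
  strictly above.\<close>

lemma supporting_at_center_imp_constant:
  fixes S :: "'a::real_inner set"
  assumes c: "center_of c S" and le: "\<And>x. x \<in> S \<Longrightarrow> a \<bullet> x \<le> a \<bullet> c" and x: "x \<in> S"
  shows "a \<bullet> x = a \<bullet> c"
  using le[OF x] le[OF center_ofD[OF c x]] by (simp add: inner_diff_right)

lemma facet_of_imp_aff_dim:
  assumes "F facet_of (P :: 'a::euclidean_space set)" "aff_dim P = int DIM('a)"
  shows "aff_dim F = int DIM('a) - 1"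
  using assms by (simp add: facet_of_def)

lemma facet_inclusion_imp_eq:
  assumes "convex P" "F facet_of P" "G facet_of P" "F \<subseteq> G"
  shows "F = G"
proof (rule ccontr)
  assume "F \<noteq> G"
  have "F face_of G"
    using assms by (meson facet_of_imp_face_of facet_of_imp_subset face_of_subset)
  with \<open>F \<noteq> G\<close> have "aff_dim F < aff_dim G"
    using assms face_of_aff_dim_lt face_of_imp_convex facet_of_imp_face_of by blast
  then show False
    using assms by (simp add: facet_of_def)
qed

text \<open>The intersection of two facets is a face; if it has the dimension of a facet, then it is a facet
  contained in both, hence equal to both.\<close>

lemma facets_eq_if_aff_dim_Int:
  assumes "convex P" "F facet_of P" "G facet_of P" "aff_dim (F \<inter> G) = aff_dim P - 1"
  shows "F = G"
proof -
  have face: "F \<inter> G face_of P"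
    using assms by (simp add: face_of_Int facet_of_imp_face_of)
  moreover have "F \<inter> G \<noteq> {}"
  proof
    \<comment> \<open>The empty set has dimension \<open>- 1\<close>, so the facet \<open>F\<close> would have this dimension too.\<close>
    assume "F \<inter> G = {}"
    with assms(4) have "aff_dim P = 0"
      by simp
    moreover have "aff_dim F \<noteq> - 1"
      using assms(2) by (auto simp: facet_of_def aff_dim_empty)
    ultimately show False
      using assms(2) by (simp add: facet_of_def)
  qed
  ultimately have "F \<inter> G facet_of P"
    using assms(4) by (simp add: facet_of_def)
  with facet_inclusion_imp_eq[OF assms(1) this] assms(2,3) show ?thesis
    by (metis inf_le1 inf_le2)
qed

text \<open>By Baire's theorem one of the finitely many closed pieces contains a relatively open part of
  \<open>F\<close>, and a nonempty relatively open part of a convex set has full dimension in it.\<close>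

lemma convex_finite_closed_cover_aff_dim:
  fixes F :: "'a::euclidean_space set"
  assumes "convex F" "closed F" "F \<noteq> {}" "finite \<C>" and closed: "\<And>C. C \<in> \<C> \<Longrightarrow> closed C"
    and cover: "F \<subseteq> \<Union>\<C>"
  obtains C where "C \<in> \<C>" "aff_dim (F \<inter> C) = aff_dim F"
proof -
  have "\<exists>C\<in>\<C>. \<not> F \<subseteq> closure (F - C)"
  proof (rule ccontr)
    assume "\<not> ?thesis"
    then have dense: "F \<subseteq> closure (F - C)" if "C \<in> \<C>" for C
      using that by blast
    have "F \<subseteq> closure (\<Inter>((\<lambda>C. F - C) ` \<C>))"
    proof (rule Baire[OF assms(2)])
      show "countable ((\<lambda>C. F - C) ` \<C>)"
        using \<open>finite \<C>\<close> by (simp add: countable_finite)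
      show "openin (top_of_set F) T \<and> F \<subseteq> closure T" if T: "T \<in> (\<lambda>C. F - C) ` \<C>" for T
      proof -
        obtain C where C: "C \<in> \<C>" "T = F \<inter> - C"
          using T by (auto simp: Diff_eq)
        then show ?thesis
          using dense[OF C(1)] openin_open_Int[OF open_Compl[OF closed[OF C(1)]], of F]
          by (simp add: Diff_eq)
      qed
    qed
    moreover have "\<C> \<noteq> {}"
      using assms by auto
    then have "\<Inter>((\<lambda>C. F - C) ` \<C>) = {}"
      using cover by auto
    ultimately show False
      using \<open>F \<noteq> {}\<close> by simp
  qed
  then obtain C x where C: "C \<in> \<C>" and x: "x \<in> F" "x \<notin> closure (F - C)"
    by blast
  let ?U = "- closure (F - C)"
  have sub: "F \<inter> ?U \<subseteq> F \<inter> C"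
    using closure_subset[of "F - C"] by blast
  have "aff_dim F = aff_dim (F \<inter> ?U)"
    by (rule aff_dim_convex_Int_open[symmetric]) (use assms x in auto)
  also have "\<dots> \<le> aff_dim (F \<inter> C)"
    by (rule aff_dim_subset[OF sub])
  finally have "aff_dim (F \<inter> C) = aff_dim F"
    by (simp add: aff_dim_subset antisym)
  with C that show ?thesis
    by blast
qed

section \<open>Tilings by translates\<close>

lemma tile_translate_facet_of:
  fixes P :: "'a::euclidean_space set"
  shows "(+) c ` F facet_of (+) c ` P \<longleftrightarrow> F facet_of P"
  by (simp add: facet_of_def aff_dim_translation_eq)

lemma full_dim_interior_nonempty:
  fixes P :: "'a::euclidean_space set"
  assumes "polytope P" "aff_dim P = int DIM('a)"
  shows "interior P \<noteq> {}"
proof -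
  have "P \<noteq> {}"
    using assms(2) by (intro notI) simp
  then show ?thesis
    using assms by (simp add: interior_rel_interior_gen rel_interior_eq_empty polytope_imp_convex)
qed

lemma tiling_interior_disjoint:
  fixes P :: "'a::euclidean_space set"
  assumes P: "polytope P" "aff_dim P = int DIM('a)" and tiling: "facet_to_facet_tiling P D"
    and cd: "c \<in> D" "d \<in> D" "c \<noteq> d"
  shows "interior ((+) c ` P) \<inter> (+) d ` P = {}"
proof -
  have "interior ((+) c ` P) \<inter> interior ((+) d ` P) = {}"
    using tiling cd unfolding facet_to_facet_tiling_def by blast
  then have "interior ((+) c ` P) \<inter> closure (interior ((+) d ` P)) = {}"
    by (simp add: open_Int_closure_eq_empty)
  moreover have "closure (interior ((+) d ` P)) = closure ((+) d ` P)"
    using P full_dim_interior_nonempty[OF P]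
    by (intro convex_closure_interior) (auto simp: interior_translation polytope_imp_convex)
  ultimately have "interior ((+) c ` P) \<inter> closure ((+) d ` P) = {}"
    by simp
  then show ?thesis
    using Int_mono[OF order_refl closure_subset] by (metis subset_empty)
qed

text \<open>A tile contains a ball of a radius \<open>r\<close> common to all tiles, so the positions of
  different tiles have distance at least \<open>r\<close>.  This is what makes the tiling locally finite.\<close>

lemma tiling_uniform_discrete:
  fixes P :: "'a::euclidean_space set"
  assumes P: "polytope P" "aff_dim P = int DIM('a)" and tiling: "facet_to_facet_tiling P D"
  shows "uniform_discrete D"
proof -
  obtain a where "a \<in> interior P"
    using full_dim_interior_nonempty[OF P] by blast
  then obtain r where r: "r > 0" "ball a r \<subseteq> P"
    using mem_interior by blast
  show ?thesis
  proof (rule uniformI1[OF \<open>r > 0\<close>], rule ccontr)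
    fix c d assume cd: "c \<in> D" "d \<in> D" "dist c d < r" "c \<noteq> d"
    have "c + a - d \<in> P"
      using cd r by (intro subsetD[OF r(2)]) (simp add: dist_norm norm_minus_commute algebra_simps)
    then have "c + a \<in> (+) d ` P"
      by (rule rev_image_eqI) simp
    moreover have "c + a \<in> interior ((+) c ` P)"
      using \<open>a \<in> interior P\<close> by (simp add: interior_translation)
    ultimately show False
      using tiling_interior_disjoint[OF P tiling cd(1,2,4)] by blast
  qed
qed

text \<open>Every point of a facet is a limit of points outside the tile, and these lie in other tiles.  The
  tiling is locally finite, so finitely many other tiles cover the facet, and one of them
  meets it in dimension \<open>n - 1\<close>.  As the tiling is facet to facet, this tile shares exactly the
  given facet.\<close>

lemma tiling_neighbour_across_facet:
  fixes P :: "'a::euclidean_space set"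
  assumes P: "polytope P" "aff_dim P = int DIM('a)" and tiling: "facet_to_facet_tiling P D"
    and c: "c \<in> D" and F: "F facet_of P"
  obtains d where "d \<in> D" "d \<noteq> c" "(+) c ` F facet_of (+) d ` P"
proof -
  define tile where "tile d = (+) d ` P" for d
  define G where "G = (+) c ` F"
  have tile: "polytope (tile d)" "closed (tile d)" "bounded (tile d)"
    "aff_dim (tile d) = int DIM('a)" for d
    using P unfolding tile_def
    by (simp_all add: polytope_imp_closed polytope_imp_bounded polytope_translation_eq
        aff_dim_translation_eq closed_translation bounded_translation)
  have convex: "convex (tile c)"
    using tile(1) polytope_imp_convex by blast
  have disjoint: "interior (tile c) \<inter> tile d = {}" if "d \<in> D" "d \<noteq> c" for d
    using tiling_interior_disjoint[OF P tiling c that(1)] that(2) unfolding tile_def by simp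
  have cover: "(\<Union>d\<in>D. tile d) = UNIV"
    using tiling unfolding facet_to_facet_tiling_def tile_def by simp
  have common: "tile c \<inter> tile d facet_of tile c \<and> tile c \<inter> tile d facet_of tile d"
    if "d \<in> D" "d \<noteq> c" "aff_dim (tile c \<inter> tile d) = int DIM('a) - 1" for d
    using tiling c that unfolding facet_to_facet_tiling_def tile_def by simp
  have G: "G facet_of tile c"
    using F by (simp add: tile_translate_facet_of G_def tile_def)
  then have Gface: "G face_of tile c" and "G \<noteq> {}" and Gne: "G \<noteq> tile c"
    by (auto simp: facet_of_def)
  have Gsub: "G \<subseteq> tile c"
    using G facet_of_imp_subset by blast
  have "convex G" "closed G"
    using face_of_imp_convex[OF Gface] face_of_imp_closed[OF convex tile(2) Gface] by auto
  have Gdim: "aff_dim G = int DIM('a) - 1"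
    using facet_of_imp_aff_dim[OF G tile(4)] .
  have ud: "uniform_discrete (D - {c})"
    by (rule uniform_discrete_subset[OF tiling_uniform_discrete[OF P tiling]]) blast
  \<comment> \<open>The union of the other tiles is closed, being the sum of a closed and a compact set.\<close>
  have "(\<Union>d\<in>D - {c}. tile d) = (\<Union>x\<in>D - {c}. \<Union>y\<in>P. {x + y})"
    unfolding tile_def by auto
  then have "closed (\<Union>d\<in>D - {c}. tile d)"
    using closed_compact_sums[OF uniform_discrete_imp_closed[OF ud] polytope_imp_compact[OF P(1)]]
    by simp
  moreover have "- tile c \<subseteq> (\<Union>d\<in>D - {c}. tile d)"
    using cover by blast
  ultimately have "closure (- tile c) \<subseteq> (\<Union>d\<in>D - {c}. tile d)"
    by (simp add: closure_minimal)
  moreover have "G \<subseteq> closure (- tile c)"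
    using face_of_disjoint_interior[OF Gface Gne] by (auto simp: closure_complement)
  ultimately have Gcover: "G \<subseteq> (\<Union>d\<in>D - {c}. tile d)"
    by blast
  \<comment> \<open>Only the tiles that touch the given one matter, and these are finitely many.\<close>
  define N where "N = {d \<in> D - {c}. tile c \<inter> tile d \<noteq> {}}"
  have "finite N"
  proof -
    have "N \<subseteq> (\<lambda>(x,y). x - y) ` (tile c \<times> P)"
    proof
      fix d assume "d \<in> N"
      then obtain z where z: "z \<in> tile c" "z \<in> tile d"
        unfolding N_def by blast
      then obtain y where "y \<in> P" "z = d + y"
        unfolding tile_def by (elim imageE)
      with z have "(d + y, y) \<in> tile c \<times> P"
        by simp
      then show "d \<in> (\<lambda>(x,y). x - y) ` (tile c \<times> P)"
        by (rule rev_image_eqI) simp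
    qed
    moreover have "bounded ((\<lambda>(x,y). x - y) ` (tile c \<times> P))"
      by (rule bounded_minus[OF tile(3) polytope_imp_bounded[OF P(1)]])
    ultimately have "bounded N"
      using bounded_subset by blast
    moreover have "uniform_discrete N"
      by (rule uniform_discrete_subset[OF ud]) (auto simp: N_def)
    ultimately show ?thesis
      using uniform_discrete_finite_iff by blast
  qed
  have "G \<subseteq> \<Union>(tile ` N)"
    using Gcover Gsub unfolding N_def by blast
  from convex_finite_closed_cover_aff_dim[OF \<open>convex G\<close> \<open>closed G\<close> \<open>G \<noteq> {}\<close>
      finite_imageI[OF \<open>finite N\<close>] _ this]
  obtain C where "C \<in> tile ` N" and C: "aff_dim (G \<inter> C) = aff_dim G"
    using tile(2) by (metis imageE)
  from \<open>C \<in> tile ` N\<close> obtain d where "C = tile d" "d \<in> N"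
    by (rule imageE)
  then have d: "d \<in> D" "d \<noteq> c" and dim: "aff_dim (G \<inter> tile d) = aff_dim G"
    using C unfolding N_def by simp_all
  \<comment> \<open>The two tiles meet in dimension at least \<open>n - 1\<close> because the second one contains that much of
    \<open>G\<close>, and not in dimension \<open>n\<close> because their interiors are disjoint.\<close>
  define I where "I = tile c \<inter> tile d"
  have "G \<inter> I = G \<inter> tile d"
    using Gsub unfolding I_def by blast
  then have GI: "aff_dim (G \<inter> I) = int DIM('a) - 1"
    using dim Gdim by simp
  have "aff_dim I \<noteq> int DIM('a)"
  proof
    assume full: "aff_dim I = int DIM('a)"
    have "polytope I"
      unfolding I_def by (rule polytope_Int[OF tile(1) tile(1)])
    from full_dim_interior_nonempty[OF this full] obtain x where x: "x \<in> interior I"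
      by blast
    then have "x \<in> interior (tile c)" "x \<in> tile d"
      using interior_mono[of I "tile c"] interior_subset[of I] unfolding I_def by blast+
    then show False
      using disjoint[OF d] by blast
  qed
  moreover have "int DIM('a) - 1 \<le> aff_dim I"
    using aff_dim_subset[of "G \<inter> I" I] GI by simp
  ultimately have "aff_dim I = int DIM('a) - 1"
    using aff_dim_le_DIM[of I] by linarith
  then have I: "I facet_of tile c" "I facet_of tile d"
    using common[OF d] unfolding I_def by blast+
  have "aff_dim (G \<inter> I) = aff_dim (tile c) - 1"
    using GI tile(4) by simp
  from facets_eq_if_aff_dim_Int[OF convex G I(1) this] I(2) have "G facet_of tile d"
    by simp
  then show ?thesis
    by (intro that[OF d]) (simp add: G_def tile_def)
qed

text \<open>A facet and its translate have parallel hyperplanes, so the translate is either in the hyperplane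
  of \<open>F\<close> or in the opposite one.  The first case would make the bounded set \<open>F\<close>
  stable under a nonzero translation.  In the second case the translate is the opposite facet, whose center is \<open>- c\<close>.\<close>

lemma translated_facet_shift:
  fixes P :: "'a::euclidean_space set"
  assumes P: "polytope P" "aff_dim P = int DIM('a)" and sym: "center_of 0 P"
    and F: "F facet_of P" and c: "center_of c F"
    and Fu: "(+) u ` F facet_of P" and "u \<noteq> 0"
  shows "u = - 2 *\<^sub>R c"
proof -
  note poly = polytope_imp_polyhedron[OF P(1)]
  obtain a b where a: "a \<noteq> 0" "P \<subseteq> {x. a \<bullet> x \<le> b}" "F = P \<inter> {x. a \<bullet> x = b}"
    using facet_of_polyhedron[OF poly F] .
  obtain a' b' where a': "a' \<noteq> 0" "P \<subseteq> {x. a' \<bullet> x \<le> b'}" "(+) u ` F = P \<inter> {x. a' \<bullet> x = b'}"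
    using facet_of_polyhedron[OF poly Fu] .
  have Fprop: "F \<noteq> {}" "bounded F"
    using F bounded_subset[OF polytope_imp_bounded[OF P(1)] facet_of_imp_subset[OF F]]
    by (simp_all add: facet_of_def)
  obtain f where f: "f \<in> F" using Fprop by blast
  have shift: "u + x \<in> P \<and> a' \<bullet> (u + x) = b'" if "x \<in> F" for x
    using imageI[OF that, of "(+) u"] unfolding a'(3) by simp
  have const: "a' \<bullet> x = b' - a' \<bullet> u" if "x \<in> F" for x
    using shift[OF that] by (simp add: inner_add_right)
  \<comment> \<open>The sign of \<open>\<gamma>\<close> tells on which side of \<open>P\<close> the translated facet lies.\<close>
  obtain \<gamma> where \<gamma>: "a' = \<gamma> *\<^sub>R a"
    using parallel_if_constant_on_codim_1[OF facet_of_imp_aff_dim[OF F P(2)] a(1), of b a',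
        OF _ const] a(3) by auto
  have uf: "u + f \<in> P" "a' \<bullet> (u + f) = b'"
    using shift[OF f] by blast+
  have fP: "f \<in> P" "a \<bullet> f = b"
    using a(3) f by blast+
  have mP: "- x \<in> P" if "x \<in> P" for x
    using center_ofD[OF sym that] by simp
  have "\<gamma> \<noteq> 0"
    using \<gamma> a'(1) by auto
  then consider "\<gamma> > 0" | "\<gamma> < 0"
    by linarith
  then show ?thesis
  proof cases
    case 1
    have "a' \<bullet> f \<le> b'"
      using a'(2) fP by blast
    then have "a' \<bullet> f \<le> a' \<bullet> (u + f)"
      using uf by simp
    then have "a \<bullet> f \<le> a \<bullet> (u + f)"
      using \<gamma> 1 by simp
    moreover have "a \<bullet> (u + f) \<le> b"
      using a(2) uf(1) by blast
    ultimately have au: "a \<bullet> u = 0"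
      using fP(2) by (simp add: inner_add_right)
    have "u + x \<in> F" if "x \<in> F" for x
      using that shift[OF that] au unfolding a(3) by (simp add: inner_add_right)
    from bounded_translation_stable_imp_zero[OF Fprop(2,1) this] \<open>u \<noteq> 0\<close> show ?thesis
      by blast
  next
    case 2
    have "a' \<bullet> (- f) \<le> b'"
      using a'(2) mP[OF fP(1)] by blast
    then have "\<gamma> * (- b) \<le> \<gamma> * (a \<bullet> (u + f))"
      using uf \<gamma> fP by simp
    then have "a \<bullet> (u + f) \<le> - b"
      using 2 by (simp only: mult_le_cancel_left_neg)
    moreover have "a \<bullet> - (u + f) \<le> b"
      using a(2) mP[OF uf(1)] by blast
    ultimately have au: "a \<bullet> u = - 2 * b"
      using fP by (simp add: inner_add_right inner_diff_right)
    have "2 *\<^sub>R ((-1/2) *\<^sub>R u) - x \<in> F" if x: "x \<in> F" for x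
    proof -
      have "- (u + x) \<in> P"
        using shift[OF x] mP by blast
      moreover have "a \<bullet> - (u + x) = b"
        using x au unfolding a(3) by (simp add: inner_add_right inner_diff_right)
      ultimately have "- (u + x) \<in> F"
        unfolding a(3) by simp
      then show ?thesis by simp
    qed
    then have "center_of ((-1/2) *\<^sub>R u) F"
      by (rule center_ofI)
    from center_of_unique[OF Fprop(2,1) c this] show ?thesis
      by simp
  qed
qed

text \<open>If \<open>e\<close> is the neighbour of the tile \<open>d\<close> across the facet \<open>d + F\<close>, then both \<open>F\<close> and its
  translate by \<open>d - e\<close> are facets of \<open>P\<close>, hence opposite ones, which gives \<open>e = d + 2 c\<close>.\<close>

lemma tiling_translation_vector:
  fixes P :: "'a::euclidean_space set"
  assumes P: "polytope P" "aff_dim P = int DIM('a)" and sym: "center_of 0 P"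
    and tiling: "facet_to_facet_tiling P D"
    and F: "F facet_of P" and c: "center_of c F" and d: "d \<in> D"
  shows "d + 2 *\<^sub>R c \<in> D"
proof -
  obtain e where e: "e \<in> D" "e \<noteq> d" "(+) d ` F facet_of (+) e ` P"
    using tiling_neighbour_across_facet[OF P tiling d F] .
  have "(+) e ` ((+) (d - e) ` F) = (+) d ` F"
    by (simp add: image_image algebra_simps)
  with e(3) have "(+) (d - e) ` F facet_of P"
    by (metis tile_translate_facet_of)
  from translated_facet_shift[OF P sym F c this] e show ?thesis
    by (metis add.commute diff_add_cancel minus_diff_eq right_minus_eq scaleR_minus_left minus_minus)
qed

lemma facet_of_uminus:
  fixes P :: "'a::euclidean_space set"
  assumes "center_of 0 P" "F facet_of P"
  shows "uminus ` F facet_of P"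
proof -
  have eq: "uminus ` P = P"
    using assms(1) by (simp add: center_of_def)
  have "uminus ` F face_of uminus ` P"
    using assms(2) by (subst face_of_linear_image) (auto simp: linear_uminus facet_of_def inj_uminus)
  with assms(2) show ?thesis
    by (simp add: facet_of_def eq aff_dim_injective_linear_image[OF linear_uminus inj_uminus])
qed

lemma center_of_uminus: "center_of c F \<Longrightarrow> center_of (- c) (uminus ` F)"
proof (rule center_ofI)
  fix y assume c: "center_of c F" and "y \<in> uminus ` F"
  then obtain x where x: "x \<in> F" "y = - x"
    by blast
  show "2 *\<^sub>R (- c) - y \<in> uminus ` F"
    by (rule rev_image_eqI[OF center_ofD[OF c x(1)]]) (simp add: x(2))
qed

section \<open>Voronoi cells of lattices\<close>

lemma norm_le_norm_diff_iff:
  fixes y s :: "'a::real_inner"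
  shows "norm y \<le> norm (y - s) \<longleftrightarrow> 2 * (y \<bullet> s) \<le> s \<bullet> s"
  by (simp add: norm_le inner_diff inner_commute)

lemma mem_voronoi_cell_0_iff:
  fixes L :: "'a::euclidean_space set"
  shows "y \<in> voronoi_cell L 0 \<longleftrightarrow> (\<forall>s\<in>L. 2 * (y \<bullet> s) \<le> s \<bullet> s)"
  unfolding voronoi_cell_def norm_le_norm_diff_iff[symmetric] by (simp add: dist_norm)

lemma lattice_uniform_discrete:
  assumes L: "full_rank_lattice L"
  shows "uniform_discrete L"
proof -
  have "0 isolated_in L"
    using L discreteD unfolding full_rank_lattice_def by blast
  then obtain e where e: "e > 0" "\<And>y. y \<in> L \<Longrightarrow> dist 0 y < e \<Longrightarrow> y = 0"
    unfolding isolated_in_dist_Ex_iff by blast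
  show ?thesis
  proof (rule uniformI1[OF e(1)])
    fix x y assume xy: "x \<in> L" "y \<in> L" "dist x y < e"
    then have "x - y \<in> L"
      using L unfolding full_rank_lattice_def by blast
    from e(2)[OF this] xy(3) show "x = y"
      by (simp add: dist_norm norm_minus_commute)
  qed
qed

lemma voronoi_cell_center_of:
  fixes L :: "'a::euclidean_space set"
  assumes L: "full_rank_lattice L" and c: "c \<in> L"
  shows "center_of c (voronoi_cell L c)"
proof (rule center_ofI)
  fix x assume x: "x \<in> voronoi_cell L c"
  show "2 *\<^sub>R c - x \<in> voronoi_cell L c"
    unfolding voronoi_cell_def
  proof (intro CollectI ballI)
    fix s assume "s \<in> L"
    then have "c - (s - c) \<in> L"
      using L c unfolding full_rank_lattice_def by blast
    then have "dist x c \<le> dist x (c - (s - c))"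
      using x unfolding voronoi_cell_def by blast
    moreover have "dist (2 *\<^sub>R c - x) c = dist x c"
      by (simp add: dist_norm scaleR_2 norm_minus_commute)
    moreover have "(2 *\<^sub>R c - x) - s = - (x - (c - (s - c)))"
      by (simp add: algebra_simps scaleR_2)
    then have "dist (2 *\<^sub>R c - x) s = dist x (c - (s - c))"
      unfolding dist_norm by (simp only: norm_minus_cancel)
    ultimately show "dist (2 *\<^sub>R c - x) c \<le> dist (2 *\<^sub>R c - x) s"
      by simp
  qed
qed

text \<open>Near \<open>f\<close> only lattice vectors of norm at most \<open>2 (norm f + 1)\<close> can compete with the origin, and
  there are finitely many.  If none of their bisectors contained \<open>f\<close>, all the inequalities would be
  strict at \<open>f\<close> and so persist in a neighbourhood.\<close>

lemma voronoi_boundary_on_bisector: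
  fixes L :: "'a::euclidean_space set"
  assumes L: "full_rank_lattice L" and f: "f \<in> voronoi_cell L 0" "f \<notin> interior (voronoi_cell L 0)"
  shows "\<exists>l\<in>L. l \<noteq> 0 \<and> 2 * (f \<bullet> l) = l \<bullet> l"
proof (rule ccontr)
  assume off: "\<not> ?thesis"
  have less: "l \<bullet> f < (l \<bullet> l) / 2" if "l \<in> L" "l \<noteq> 0" for l
  proof -
    have "2 * (f \<bullet> l) \<le> l \<bullet> l" "2 * (f \<bullet> l) \<noteq> l \<bullet> l"
      using f(1) off that unfolding mem_voronoi_cell_0_iff by blast+
    then show ?thesis
      by (simp add: inner_commute[of l f])
  qed
  define R where "R = 2 * (norm f + 1)"
  define B where "B = {l \<in> L. l \<noteq> 0 \<and> norm l \<le> R}"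
  have "bounded B"
    unfolding bounded_iff B_def by blast
  moreover have "uniform_discrete B"
    by (rule uniform_discrete_subset[OF lattice_uniform_discrete[OF L]]) (simp add: B_def)
  ultimately have "finite B"
    using uniform_discrete_finite_iff by blast
  define U where "U = ball f 1 \<inter> (\<Inter>l\<in>B. {y. l \<bullet> y < (l \<bullet> l) / 2})"
  have "open U"
    unfolding U_def using \<open>finite B\<close> by (intro open_Int open_INT ballI open_halfspace_lt) auto
  moreover have "f \<in> U"
    using less by (simp add: U_def B_def)
  moreover have "U \<subseteq> voronoi_cell L 0"
  proof
    fix y assume y: "y \<in> U"
    have "2 * (y \<bullet> l) \<le> l \<bullet> l" if l: "l \<in> L" for l
    proof (cases "l = 0 \<or> l \<in> B")
      case True
      then show ?thesis
        using y by (auto simp: U_def inner_commute[of y l])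
    next
      case False
      then have "R \<le> norm l"
        using l by (auto simp: B_def)
      moreover have "norm y \<le> norm f + 1"
        using y norm_triangle_ineq2[of y f] by (simp add: U_def dist_norm norm_minus_commute)
      ultimately have "2 * norm y \<le> norm l"
        unfolding R_def by simp
      then have "2 * norm y * norm l \<le> norm l * norm l"
        by (rule mult_right_mono) simp
      then show ?thesis
        using norm_cauchy_schwarz[of y l] by (simp add: dot_square_norm power2_eq_square)
    qed
    then show "y \<in> voronoi_cell L 0"
      unfolding mem_voronoi_cell_0_iff by blast
  qed
  ultimately have "f \<in> interior (voronoi_cell L 0)"
    by (meson interior_maximal subsetD)
  with f(2) show False
    by simp
qed

text \<open>The center \<open>c\<close> of a facet \<open>G\<close> lies on the bisector of some lattice vector \<open>l\<close>.  This bisector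
  supports the cell, so it contains \<open>G\<close>, and \<open>G\<close> is its intersection with the cell.  The
  reflection in \<open>l / 2\<close> preserves the lattice and exchanges the origin with \<open>l\<close>; it therefore maps this
  intersection to itself.  By uniqueness of centers \<open>c = l / 2\<close>: the vector from the center of
  the cell to the center of a facet is normal to that facet.\<close>

lemma voronoi_facet_center:
  fixes L :: "'a::euclidean_space set"
  assumes L: "full_rank_lattice L" and V: "convex (voronoi_cell L 0)" "bounded (voronoi_cell L 0)"
    and G: "G facet_of voronoi_cell L 0" and c: "center_of c G" and x: "x \<in> G"
  shows "c \<bullet> x = c \<bullet> c"
proof -
  let ?V = "voronoi_cell L 0"
  have face: "G face_of ?V" and ne: "G \<noteq> {}" "G \<noteq> ?V"
    using G by (auto simp: facet_of_def)
  have sub: "G \<subseteq> ?V"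
    using facet_of_imp_subset[OF G] .
  have "c \<in> G"
    by (rule center_mem[OF face_of_imp_convex[OF face] ne(1) c])
  then have "c \<in> ?V" "c \<notin> interior ?V"
    using sub face_of_disjoint_interior[OF face ne(2)] by auto
  then obtain l where l: "l \<in> L" "l \<noteq> 0" "2 * (c \<bullet> l) = l \<bullet> l"
    using voronoi_boundary_on_bisector[OF L] by blast
  have supp: "l \<bullet> y \<le> l \<bullet> l / 2" if "y \<in> ?V" for y
    using that l(1) unfolding mem_voronoi_cell_0_iff by (auto simp: inner_commute)
  have "l \<bullet> y \<le> l \<bullet> c" if "y \<in> G" for y
  proof -
    have "l \<bullet> y \<le> l \<bullet> l / 2"
      using supp sub that by blast
    then show ?thesis
      using l(3) by (simp add: inner_commute)
  qed
  from supporting_at_center_imp_constant[OF c this]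
  have const: "l \<bullet> y = l \<bullet> l / 2" if "y \<in> G" for y
    using that l(3) by (simp add: inner_commute[of l c])
  define H where "H = ?V \<inter> {y. l \<bullet> y = l \<bullet> l / 2}"
  have GH: "G \<subseteq> H"
    using const sub unfolding H_def by blast
  have Hface: "H face_of ?V"
    unfolding H_def by (rule face_of_Int_supporting_hyperplane_le[OF V(1) supp])
  have "0 \<in> ?V"
    by (simp add: mem_voronoi_cell_0_iff)
  moreover have "0 \<notin> H"
    using l(2) by (simp add: H_def)
  ultimately have "H \<noteq> ?V"
    by blast
  then have "aff_dim H < aff_dim ?V"
    by (rule face_of_aff_dim_lt[OF V(1) Hface])
  moreover have "aff_dim ?V - 1 \<le> aff_dim H"
    using aff_dim_subset[OF GH] G by (simp add: facet_of_def)
  ultimately have "H facet_of ?V"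
    using Hface GH ne(1) by (auto simp: facet_of_def)
  then have "G = H"
    using facet_inclusion_imp_eq[OF V(1) G _ GH] by blast
  \<comment> \<open>A point of the cell at the same distance from \<open>0\<close> and \<open>l\<close> has both among its nearest lattice
    points; then so does its reflection in \<open>l / 2\<close>.\<close>
  have "2 *\<^sub>R ((1/2) *\<^sub>R l) - y \<in> G" if y: "y \<in> G" for y
  proof -
    have "l - y \<in> ?V"
      unfolding mem_voronoi_cell_0_iff
    proof
      fix s assume "s \<in> L"
      then have "l - s \<in> L"
        using L l(1) unfolding full_rank_lattice_def by blast
      then have "2 * (y \<bullet> (l - s)) \<le> (l - s) \<bullet> (l - s)"
        using sub y unfolding mem_voronoi_cell_0_iff[symmetric] by (auto simp: mem_voronoi_cell_0_iff)
      then show "2 * ((l - y) \<bullet> s) \<le> s \<bullet> s"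
        using const[OF y] by (simp add: inner_diff inner_commute)
    qed
    then show ?thesis
      using const[OF y] unfolding \<open>G = H\<close> H_def by (simp add: inner_diff_right)
  qed
  then have "center_of ((1/2) *\<^sub>R l) G"
    by (rule center_ofI)
  then have "c = (1/2) *\<^sub>R l"
    by (rule center_of_unique[OF bounded_subset[OF V(2) sub] ne(1) c])
  then show ?thesis
    using const[OF x] by simp
qed

section \<open>The lattice of periods of a tiling\<close>

text \<open>The vectors by which the whole arrangement of tiles is invariant.  This group contains the lattice
  generated by the translation vectors and has the advantage that the closure under subtraction comes for
  free, without a description of the generated group.\<close>

definition translation_periods :: "'a::ab_group_add set \<Rightarrow> 'a set" where
  "translation_periods D = {z. \<forall>d\<in>D. d + z \<in> D \<and> d - z \<in> D}"

lemma translation_periods_diff: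
  assumes "x \<in> translation_periods D" "y \<in> translation_periods D"
  shows "x - y \<in> translation_periods D"
proof -
  have "d + (x - y) \<in> D" "d - (x - y) \<in> D" if "d \<in> D" for d
  proof -
    have "d + x - y \<in> D" "d + y - x \<in> D"
      using assms that unfolding translation_periods_def by blast+
    then show "d + (x - y) \<in> D" "d - (x - y) \<in> D"
      by (simp_all add: algebra_simps)
  qed
  then show ?thesis
    unfolding translation_periods_def by blast
qed

lemma uniform_discrete_injective_linear_image:
  fixes f :: "'a::euclidean_space \<Rightarrow> 'b::euclidean_space"
  assumes f: "linear f" "inj f" and S: "uniform_discrete S"
  shows "uniform_discrete (f ` S)"
proof -
  obtain B where B: "B > 0" "\<And>x. B * norm x \<le> norm (f x)"
    using linear_inj_bounded_below_pos[OF f] by blast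
  obtain e where e: "e > 0" "\<And>x y. x \<in> S \<Longrightarrow> y \<in> S \<Longrightarrow> dist x y < e \<Longrightarrow> x = y"
    using S unfolding uniform_discrete_def by blast
  have "f x = f y" if "x \<in> S" "y \<in> S" "dist (f x) (f y) < B * e" for x y
  proof -
    have "B * dist x y \<le> dist (f x) (f y)"
      using B(2)[of "x - y"] by (simp add: dist_norm linear_diff[OF f(1)])
    then have "B * dist x y < B * e"
      using that(3) by linarith
    then have "dist x y < e"
      using B(1) by simp
    then show ?thesis
      using e(2) that by blast
  qed
  then show ?thesis
    using B(1) e(1) by (intro uniformI1[of "B * e"]) auto
qed

text \<open>The matrix \<open>A\<close> is an isometry from the form with the matrix \<open>A\<^sup>T A\<close> to the Euclidean norm.\<close>

lemma inner_gram:
  fixes A :: "real ^ 'n ^ 'n"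
  shows "x \<bullet> ((transpose A ** A) *v y) = (A *v x) \<bullet> (A *v y)"
  by (metis dot_lmul_matrix matrix_vector_mul_assoc transpose_matrix_vector inner_commute)

text \<open>The inequality for a vector \<open>t\<close> says that \<open>A x\<close> is at least as near to the origin as to \<open>A t\<close>;
  together with the inequality for \<open>- t\<close> it bounds an absolute value.\<close>

lemma mem_voronoi_form_polytope_iff:
  fixes A :: "real ^ 'n ^ 'n"
  shows "x \<in> voronoi_form_polytope (transpose A ** A) T \<longleftrightarrow>
    (\<forall>t\<in>T. \<bar>2 * ((A *v x) \<bullet> (A *v t))\<bar> \<le> (A *v t) \<bullet> (A *v t))"
proof -
  have quad: "quad_form (transpose A ** A) x \<le> quad_form (transpose A ** A) (x - t) \<longleftrightarrow>
      2 * ((A *v x) \<bullet> (A *v t)) \<le> (A *v t) \<bullet> (A *v t)" for t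
    unfolding quad_form_def inner_gram
    by (simp add: matrix_vector_mult_diff_distrib inner_diff inner_commute)
  have neg: "A *v (- t) = - (A *v t)" for t
    by (simp add: linear_neg)
  show ?thesis
    unfolding voronoi_form_polytope_def mem_Collect_eq quad ball_Un ball_simps neg
    by (auto simp: abs_le_iff)
qed

text \<open>Let \<open>L\<close> be the lattice of periods.  The Voronoi cell of \<open>A L\<close> is contained in \<open>A P\<close>, because \<open>P\<close> is
  cut out by the bisectors of some vectors of \<open>L\<close>.  Conversely, for \<open>x\<close> in the interior of \<open>P\<close> let
  \<open>A y'\<close> be a point of \<open>A L\<close> nearest to \<open>A x\<close>.  Then the origin is nearest to \<open>A (x - y')\<close>, so
  \<open>x - y'\<close> satisfies all the inequalities that define \<open>P\<close>, and \<open>x\<close> lies in the tile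
  \<open>y' + P\<close>.  Interiors of tiles are disjoint, so \<open>y' = 0\<close>, and \<open>A x\<close> is in the Voronoi cell of the
  origin.  The boundary of \<open>P\<close> follows by continuity.\<close>

lemma tiling_voronoi_polytope:
  fixes P :: "(real ^ 'n) set" and A :: "real ^ 'n ^ 'n"
  assumes P: "polytope P" "aff_dim P = int DIM(real ^ 'n)" and tiling: "facet_to_facet_tiling P D"
    and A: "invertible A" and T: "T \<subseteq> translation_periods D"
    and PQ: "P = voronoi_form_polytope (transpose A ** A) T"
  shows "voronoi_polytope ((*v) A ` P)"
proof -
  define L where "L = translation_periods D"
  define M where "M = (*v) A ` L"
  have lin: "linear ((*v) A)" and inj: "inj ((*v) A)"
    using A by (simp_all add: invertible_eq_bij bij_is_inj)
  have zero: "0 \<in> L"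
    by (simp add: L_def translation_periods_def)
  have diff: "x - y \<in> L" if "x \<in> L" "y \<in> L" for x y
    using translation_periods_diff that unfolding L_def by blast
  have add: "x + y \<in> L" if "x \<in> L" "y \<in> L" for x y
    using diff[OF that(1) diff[OF zero that(2)]] by simp
  have "P \<noteq> {}"
    using P(2) by (intro notI) simp
  have "(\<Union>d\<in>D. (+) d ` P) = UNIV"
    using tiling unfolding facet_to_facet_tiling_def by simp
  then obtain d where d: "d \<in> D"
    by (metis SUP_empty ex_in_conv empty_not_UNIV)
  have period: "d + z \<in> D" if "z \<in> L" for z
    using that d unfolding L_def translation_periods_def by blast
  have "uniform_discrete L"
  proof -
    obtain e where e: "e > 0" "\<And>x y. x \<in> D \<Longrightarrow> y \<in> D \<Longrightarrow> dist x y < e \<Longrightarrow> x = y"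
      using tiling_uniform_discrete[OF P tiling] unfolding uniform_discrete_def by blast
    show ?thesis
    proof (rule uniformI1[OF e(1)])
      fix x y assume "x \<in> L" "y \<in> L" "dist x y < e"
      then show "x = y"
        using e(2)[OF period period, of x y] by simp
    qed
  qed
  then have ud: "uniform_discrete M"
    unfolding M_def by (rule uniform_discrete_injective_linear_image[OF lin inj])
  have memP: "x \<in> P \<longleftrightarrow> (\<forall>t\<in>T. \<bar>2 * ((A *v x) \<bullet> (A *v t))\<bar> \<le> (A *v t) \<bullet> (A *v t))" for x
    unfolding PQ mem_voronoi_form_polytope_iff ..
  \<comment> \<open>A vector orthogonal to the images of all \<open>t \<in> T\<close> gives a direction in which \<open>P\<close> is unbounded.\<close>
  have span: "span M = UNIV"
  proof (rule ccontr)
    assume "span M \<noteq> UNIV"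
    then obtain w where w: "w \<noteq> 0" "\<And>x. x \<in> span M \<Longrightarrow> w \<bullet> x = 0"
      using span_not_UNIV_orthogonal by blast
    obtain v where v: "w = A *v v"
      using A by (metis invertible_eq_bij bij_pointE)
    have "w \<bullet> (A *v t) = 0" if "t \<in> T" for t
      using that T w(2) span_base unfolding M_def L_def by blast
    then have "v + x \<in> P" if "x \<in> P" for x
      using that unfolding memP v by (simp add: matrix_vector_right_distrib inner_add_left)
    from bounded_translation_stable_imp_zero[OF polytope_imp_bounded[OF P(1)] \<open>P \<noteq> {}\<close> this]
    show False
      using w(1) v by simp
  qed
  have lattice: "full_rank_lattice M"
    unfolding full_rank_lattice_def
  proof (intro conjI ballI)
    show "0 \<in> M"
      unfolding M_def using zero by (rule rev_image_eqI) simp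
    show "discrete M"
      using ud by (rule uniform_discrete_imp_discrete)
    fix x y assume "x \<in> M" "y \<in> M"
    then obtain x' y' where "x' \<in> L" "y' \<in> L" "x = A *v x'" "y = A *v y'"
      unfolding M_def by blast
    then show "x - y \<in> M"
      unfolding M_def by (intro rev_image_eqI[OF diff]) (auto simp: matrix_vector_mult_diff_distrib)
  qed (rule span)
  have interior_cell: "norm (A *v x) \<le> norm (A *v x - A *v z)" if x: "x \<in> interior P" and z: "z \<in> L" for x z
  proof -
    have "M \<noteq> {}"
      using zero unfolding M_def by blast
    then obtain y where "y \<in> M" and nearest: "\<And>s. s \<in> M \<Longrightarrow> dist (A *v x) y \<le> dist (A *v x) s"
      using distance_attains_inf[OF uniform_discrete_imp_closed[OF ud]] by blast
    then obtain y' where y': "y' \<in> L" "y = A *v y'"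
      unfolding M_def by blast
    have le: "norm (A *v (x - y')) \<le> norm (A *v (x - y') - A *v t)" if "t \<in> L" for t
    proof -
      have "A *v (y' + t) \<in> M"
        unfolding M_def using add[OF y'(1) that] by (rule imageI)
      from nearest[OF this] show ?thesis
        by (simp add: dist_norm y'(2) matrix_vector_right_distrib matrix_vector_mult_diff_distrib diff_diff_add)
    qed
    have "x - y' \<in> P"
      unfolding memP
    proof
      fix t assume "t \<in> T"
      then have t: "t \<in> L" "- t \<in> L"
        using T diff[OF zero, of t] unfolding L_def by auto
      have neg: "A *v (- t) = - (A *v t)"
        by (simp add: linear_neg)
      show "\<bar>2 * ((A *v (x - y')) \<bullet> (A *v t))\<bar> \<le> (A *v t) \<bullet> (A *v t)"
        using le[OF t(1)] le[OF t(2)] unfolding norm_le_norm_diff_iff neg by simp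
    qed
    then have "d + y' + (x - y') \<in> (+) (d + y') ` P"
      by (rule imageI)
    moreover have "d + x \<in> interior ((+) d ` P)"
      unfolding interior_translation using x by (rule imageI)
    ultimately have "d = d + y'"
      using tiling_interior_disjoint[OF P tiling d period[OF y'(1)]] by (simp add: disjoint_iff) metis
    then have "dist (A *v x) 0 \<le> dist (A *v x) (A *v z)"
      using nearest[of "A *v z"] z y' by (simp add: M_def)
    then show ?thesis
      by (simp add: dist_norm)
  qed
  have cell: "norm (A *v x) \<le> norm (A *v x - A *v z)" if x: "x \<in> P" and z: "z \<in> L" for x z
  proof -
    let ?C = "{x. norm (A *v x) \<le> norm (A *v x - A *v z)}"
    have "closed ?C"
      by (intro closed_Collect_le continuous_intros linear_continuous_on_compose[OF _ lin])
    then have "closure (interior P) \<subseteq> ?C"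
      using interior_cell[OF _ z] by (intro closure_minimal) auto
    moreover have "P \<subseteq> closure (interior P)"
      using convex_closure_interior[OF polytope_imp_convex[OF P(1)] full_dim_interior_nonempty[OF P]]
        closure_subset by simp
    ultimately show ?thesis
      using x by blast
  qed
  have "(*v) A ` P = voronoi_cell M 0"
  proof
    show "(*v) A ` P \<subseteq> voronoi_cell M 0"
    proof
      fix y assume "y \<in> (*v) A ` P"
      then obtain x where x: "x \<in> P" "y = A *v x"
        by blast
      show "y \<in> voronoi_cell M 0"
        unfolding mem_voronoi_cell_0_iff norm_le_norm_diff_iff[symmetric] M_def x(2)
        using cell[OF x(1)] by simp
    qed
    show "voronoi_cell M 0 \<subseteq> (*v) A ` P"
    proof
      fix y assume y: "y \<in> voronoi_cell M 0"
      obtain x where x: "y = A *v x"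
        using A by (metis invertible_eq_bij bij_pointE)
      have "x \<in> P"
        unfolding memP
      proof
        fix t assume "t \<in> T"
        then have "t \<in> L" "- t \<in> L"
          using T diff[OF zero, of t] unfolding L_def by auto
        then have "A *v t \<in> M" "A *v (- t) \<in> M"
          unfolding M_def by (simp_all only: imageI)
        then have "2 * (y \<bullet> (A *v t)) \<le> (A *v t) \<bullet> (A *v t)"
          "2 * (y \<bullet> (A *v (- t))) \<le> (A *v (- t)) \<bullet> (A *v (- t))"
          using y unfolding mem_voronoi_cell_0_iff by blast+
        moreover have "A *v (- t) = - (A *v t)"
          by (simp add: linear_neg)
        ultimately show "\<bar>2 * ((A *v x) \<bullet> (A *v t))\<bar> \<le> (A *v t) \<bullet> (A *v t)"
          unfolding x by (simp add: abs_le_iff)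
      qed
      then show "y \<in> (*v) A ` P"
        unfolding x by (rule imageI)
    qed
  qed
  then show ?thesis
    unfolding voronoi_polytope_def using lattice full_rank_lattice_def by metis
qed

section \<open>Equivalence of the three conditions\<close>

theorem proposition1:
  fixes P :: "(real ^ 'n) set"
    and m :: nat
    and p t :: "nat \<Rightarrow> real ^ 'n"
    and F :: "nat \<Rightarrow> (real ^ 'n) set"
    and A Q :: "real ^ 'n ^ 'n"
  assumes "parallelotope P"
    and "center_of 0 P"
    and "P = {x. \<forall>j\<in>{1..m}. - (1/2) * (p j \<bullet> t j) \<le> p j \<bullet> x \<and> p j \<bullet> x \<le> (1/2) * (p j \<bullet> t j)}"
    and "\<And>j. j \<in> {1..m} \<Longrightarrow> F j = {x \<in> P. p j \<bullet> x = (1/2) * (p j \<bullet> t j)}"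
    and "facet_pairs P m F"
    and "\<And>j. j \<in> {1..m} \<Longrightarrow> p j \<noteq> 0"
    and "\<And>j. j \<in> {1..m} \<Longrightarrow> center_of ((1/2) *\<^sub>R t j) (F j)"
    and "invertible A"
    and "Q = transpose A ** A"
  shows "(voronoi_polytope ((*v) A ` P) \<longleftrightarrow> P = voronoi_form_polytope Q (t ` {1..m})) \<and>
         (P = voronoi_form_polytope Q (t ` {1..m}) \<longleftrightarrow>
            (\<exists>\<gamma> :: nat \<Rightarrow> real. \<forall>j\<in>{1..m}. \<gamma> j *\<^sub>R p j = Q *v t j))"
proof -
  let ?T = "t ` {1..m}"
  let ?i = "voronoi_polytope ((*v) A ` P)"
  let ?ii = "P = voronoi_form_polytope Q ?T"
  let ?iii = "\<exists>\<gamma> :: nat \<Rightarrow> real. \<forall>j\<in>{1..m}. \<gamma> j *\<^sub>R p j = Q *v t j"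
  note sym = assms(2) and describe = assms(3) and facet_eq = assms(4) and normal = assms(6)
    and center = assms(7) and Q = assms(9)
  obtain D where P: "polytope P" "aff_dim P = int DIM(real ^ 'n)"
    and tiling: "facet_to_facet_tiling P D"
    using assms(1) unfolding parallelotope_def by blast
  have lin: "linear ((*v) A)" and inj: "inj ((*v) A)"
    using assms(8) by (simp_all add: invertible_eq_bij bij_is_inj)
  have "P \<noteq> {}"
    using P(2) by (intro notI) simp
  have zero: "0 \<in> P"
    by (rule center_mem[OF polytope_imp_convex[OF P(1)] \<open>P \<noteq> {}\<close> sym])
  have facet: "F j facet_of P" if "j \<in> {1..m}" for j
    using assms(5) that unfolding facet_pairs_def by blast
  \<comment> \<open>The slab of index \<open>j\<close> has positive width, since otherwise \<open>P\<close> would be contained in a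
    hyperplane.\<close>
  have pos: "p j \<bullet> t j > 0" if j: "j \<in> {1..m}" for j
  proof (rule ccontr)
    assume "\<not> p j \<bullet> t j > 0"
    moreover have "- (1/2) * (p j \<bullet> t j) \<le> p j \<bullet> 0"
      using zero j unfolding describe by blast
    ultimately have "p j \<bullet> t j = 0"
      by simp
    then have "P \<subseteq> {x. p j \<bullet> x = 0}"
      using j by (subst describe) force
    then have "aff_dim P \<le> aff_dim {x. p j \<bullet> x = 0}"
      by (rule aff_dim_subset)
    then show False
      using normal[OF j] P(2) by simp
  qed
  have t_nonzero: "t j \<noteq> 0" if "j \<in> {1..m}" for j
    using pos[OF that] by auto
  have gram: "x \<bullet> (Q *v y) = (A *v x) \<bullet> (A *v y)" for x y
    unfolding Q by (rule inner_gram)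
  have mem_PQ: "x \<in> voronoi_form_polytope Q ?T \<longleftrightarrow>
      (\<forall>j\<in>{1..m}. \<bar>2 * (x \<bullet> (Q *v t j))\<bar> \<le> t j \<bullet> (Q *v t j))" for x
    unfolding Q mem_voronoi_form_polytope_iff inner_gram by simp
  \<comment> \<open>Both (i) and (ii) yield (iii) in this way: the bisector of \<open>t j\<close> for the form \<open>Q\<close>
    contains the facet \<open>F j\<close>, which determines its normal vector up to a factor.\<close>
  have normal_parallel: "\<exists>\<gamma>. \<gamma> *\<^sub>R p j = Q *v t j"
    if j: "j \<in> {1..m}" and const: "\<And>x. x \<in> F j \<Longrightarrow> x \<bullet> (Q *v t j) = t j \<bullet> (Q *v t j) / 2" for j
  proof -
    have "p j \<bullet> x = (1/2) * (p j \<bullet> t j)" if "x \<in> F j" for x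
      using that facet_eq[OF j] by blast
    moreover have "(Q *v t j) \<bullet> x = t j \<bullet> (Q *v t j) / 2" if "x \<in> F j" for x
      using const[OF that] by (simp add: inner_commute)
    ultimately obtain \<gamma> where "Q *v t j = \<gamma> *\<^sub>R p j"
      using parallel_if_constant_on_codim_1[OF facet_of_imp_aff_dim[OF facet[OF j] P(2)] normal[OF j]]
      by metis
    then show ?thesis
      by metis
  qed
  have i_iii: ?iii if ?i
  proof -
    obtain L c where L: "full_rank_lattice L" "c \<in> L" and cell: "(*v) A ` P = voronoi_cell L c"
      using \<open>?i\<close> unfolding voronoi_polytope_def by blast
    have poly: "polytope ((*v) A ` P)"
      by (rule polytope_linear_image[OF lin P(1)])
    have neg: "A *v (- x) = - (A *v x)" for x
      by (simp add: linear_neg)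
    have "center_of 0 ((*v) A ` P)"
    proof (rule center_ofI)
      fix y assume "y \<in> (*v) A ` P"
      then obtain x where x: "x \<in> P" "y = A *v x"
        by blast
      show "2 *\<^sub>R 0 - y \<in> (*v) A ` P"
        by (rule rev_image_eqI[OF center_ofD[OF sym x(1)]]) (simp add: x(2) neg)
    qed
    moreover have "center_of c ((*v) A ` P)"
      unfolding cell by (rule voronoi_cell_center_of[OF L])
    ultimately have "c = 0"
      using center_of_unique[OF polytope_imp_bounded[OF poly]] \<open>P \<noteq> {}\<close> by blast
    with cell have cell: "(*v) A ` P = voronoi_cell L 0"
      by simp
    have dim: "aff_dim ((*v) A ` S) = aff_dim S" for S
      by (rule aff_dim_injective_linear_image[OF lin inj])
    have "\<exists>\<gamma>. \<gamma> *\<^sub>R p j = Q *v t j" if j: "j \<in> {1..m}" for j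
    proof (rule normal_parallel[OF j])
      fix x assume x: "x \<in> F j"
      have G: "(*v) A ` F j facet_of voronoi_cell L 0"
        unfolding cell[symmetric] using facet[OF j]
        by (simp add: facet_of_def dim face_of_linear_image[OF lin inj])
      have c: "center_of ((1/2) *\<^sub>R (A *v t j)) ((*v) A ` F j)"
      proof (rule center_ofI)
        fix y assume "y \<in> (*v) A ` F j"
        then obtain x where x: "x \<in> F j" "y = A *v x"
          by blast
        show "2 *\<^sub>R ((1/2) *\<^sub>R (A *v t j)) - y \<in> (*v) A ` F j"
          by (rule rev_image_eqI[OF center_ofD[OF center[OF j] x(1)]])
            (simp add: x(2) matrix_vector_mult_diff_distrib)
      qed
      have "((1/2) *\<^sub>R (A *v t j)) \<bullet> (A *v x) = ((1/2) *\<^sub>R (A *v t j)) \<bullet> ((1/2) *\<^sub>R (A *v t j))"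
      proof (rule voronoi_facet_center[OF L(1) _ _ G c])
        show "convex (voronoi_cell L 0)" "bounded (voronoi_cell L 0)"
          unfolding cell[symmetric] using poly polytope_imp_convex polytope_imp_bounded by auto
        show "A *v x \<in> (*v) A ` F j"
          using x by (rule imageI)
      qed
      then show "x \<bullet> (Q *v t j) = t j \<bullet> (Q *v t j) / 2"
        unfolding gram by (simp add: inner_commute)
    qed
    then show ?iii
      by metis
  qed
  have ii_iii: ?iii if ?ii
  proof -
    have "\<exists>\<gamma>. \<gamma> *\<^sub>R p j = Q *v t j" if j: "j \<in> {1..m}" for j
    proof (rule normal_parallel[OF j])
      fix x assume x: "x \<in> F j"
      have "(Q *v t j) \<bullet> y \<le> (Q *v t j) \<bullet> ((1/2) *\<^sub>R t j)" if "y \<in> F j" for y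
      proof -
        have "y \<in> voronoi_form_polytope Q ?T"
          using that facet_of_imp_subset[OF facet[OF j]] \<open>?ii\<close> by blast
        then have "\<bar>2 * (y \<bullet> (Q *v t j))\<bar> \<le> t j \<bullet> (Q *v t j)"
          using j unfolding mem_PQ by blast
        then show ?thesis
          by (simp add: inner_commute)
      qed
      from supporting_at_center_imp_constant[OF center[OF j] this x]
      show "x \<bullet> (Q *v t j) = t j \<bullet> (Q *v t j) / 2"
        by (simp add: inner_commute)
    qed
    then show ?iii
      by metis
  qed
  have iii_ii: ?ii if ?iii
  proof -
    obtain \<gamma> :: "nat \<Rightarrow> real" where \<gamma>: "\<And>j. j \<in> {1..m} \<Longrightarrow> \<gamma> j *\<^sub>R p j = Q *v t j"
      using \<open>?iii\<close> by blast
    have "(- (1/2) * (p j \<bullet> t j) \<le> p j \<bullet> x \<and> p j \<bullet> x \<le> (1/2) * (p j \<bullet> t j)) \<longleftrightarrow>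
        \<bar>2 * (x \<bullet> (Q *v t j))\<bar> \<le> t j \<bullet> (Q *v t j)" if j: "j \<in> {1..m}" for j x
    proof -
      \<comment> \<open>A positive factor turns the two inequalities of the slab into those of the form.\<close>
      have "A *v t j \<noteq> 0"
        using t_nonzero[OF j] inj by (metis injD matrix_vector_mult_0_right)
      then have "t j \<bullet> (Q *v t j) > 0"
        unfolding gram by simp
      then have "\<gamma> j * (p j \<bullet> t j) > 0"
        unfolding \<gamma>[OF j, symmetric] by (simp add: inner_commute)
      then have g: "\<gamma> j > 0"
        using pos[OF j] by (simp add: zero_less_mult_iff)
      have "\<bar>2 * (x \<bullet> (Q *v t j))\<bar> = \<gamma> j * \<bar>2 * (p j \<bullet> x)\<bar>"
        unfolding \<gamma>[OF j, symmetric] using g by (simp add: abs_mult inner_commute)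
      moreover have "t j \<bullet> (Q *v t j) = \<gamma> j * (p j \<bullet> t j)"
        unfolding \<gamma>[OF j, symmetric] by (simp add: inner_commute)
      ultimately have "\<bar>2 * (x \<bullet> (Q *v t j))\<bar> \<le> t j \<bullet> (Q *v t j) \<longleftrightarrow> \<bar>2 * (p j \<bullet> x)\<bar> \<le> p j \<bullet> t j"
        using g by simp
      then show ?thesis
        by linarith
    qed
    then have "x \<in> P \<longleftrightarrow> x \<in> voronoi_form_polytope Q ?T" for x
      unfolding mem_PQ by (subst describe) simp
    then show ?ii
      by blast
  qed
  have ii_i: ?i if ?ii
  proof (rule tiling_voronoi_polytope[OF P tiling assms(8)])
    show "?T \<subseteq> translation_periods D"
    proof
      fix s assume "s \<in> ?T"
      then obtain j where j: "j \<in> {1..m}" "s = t j"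
        by blast
      have "d + s \<in> D" "d - s \<in> D" if "d \<in> D" for d
        using tiling_translation_vector[OF P sym tiling facet[OF j(1)] center[OF j(1)] that]
          tiling_translation_vector[OF P sym tiling facet_of_uminus[OF sym facet[OF j(1)]]
            center_of_uminus[OF center[OF j(1)]] that] j(2) by simp_all
      then show "s \<in> translation_periods D"
        unfolding translation_periods_def by blast
    qed
    show "P = voronoi_form_polytope (transpose A ** A) ?T"
      using \<open>?ii\<close> unfolding Q .
  qed
  show ?thesis
    using i_iii ii_iii iii_ii ii_i by blast
qed

end
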